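(* Let $m,n$ be positive integers. For each $k\ge m$, the lattice $L^k(m,n)$ is distributive.
   Context: Fix an integer $k\ge1$. A partition $\lambda=(\lambda_1\ge\dots\ge\lambda_\ell>0)$ is a finite (possibly empty) non-increasing sequence of positive integers, $|\lambda|=\sum_i\lambda_i$, $\ell(\lambda)$ is the number of parts, and $\lambda_i=0$ for $i>\ell(\lambda)$. Its diagram is the set of cells $(i,j)$ with $1\le j\le\lambda_i$ (row $i$, column $j$; row 1 is the lowest row, and "above" means larger row index). $\lambda\subseteq\mu$ means $\lambda_i\le\mu_i$ for all $i$. A partition is $k$-bounded if $\lambda_1\le k$; $\mathcal P^k$ is the set of $k$-bounded partitions. $(m^n)$ is the partition with $n$ parts equal to $m$. For partitions $\rho\subseteq\gamma$, the skew diagram $\gamma/\rho$ is $\{(i,j):\rho_i<j\le\gamma_i\}$; the squares of $\rho$ are said to lie below $\gamma/\rho$. For a square $(i,j)\in\gamma$ (possibly in $\rho$), its hook-length in $\gamma/\rho$ is the number of cells of $\gamma/\rho$ of the form $(i,j')$ with $j'\ge j$ or $(i',j)$ with $i'\ge i$. For $\lambda\in\mathcal P^k$, the $k$-skew diagram $\lambda/^k$ is the unique skew diagram such that (i) row $i$ has $\lambda_i$ cells, (ii) no cell of the diagram has hook-length exceeding $k$, (iii) every square below the diagram has hook-length exceeding $k$. The column lengths of $\lambda/^k$ form a $k$-bounded partition, called the $k$-conjugate $\lambda^{\omega_k}$. For $\lambda,\mu\in\mathcal P^k$ write $\lambda\prec\!\!\cdot\,\mu$ when $\lambda\subseteq\mu$,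 $\lambda^{\omega_k}\subseteq\mu^{\omega_k}$ and $|\mu|-|\lambda|=1$. The partial order $\preceq$ on $\mathcal P^k$ is the reflexive-transitive closure of $\prec\!\!\cdot$; the resulting poset is $Y^k$. For $1\le m\le k$ and $n\ge1$, $L^k(m,n)=\{\mu\in\mathcal P^k:\mu\preceq(m^n)\}$ is the principal order ideal of $Y^k$ generated by $(m^n)$, ordered by $\preceq$; it is a lattice. *)

theory Defs
  imports "HOL-Algebra.Lattice"
begin

definition partition :: "nat list \<Rightarrow> bool" where
  "partition \<alpha> \<longleftrightarrow> sorted_wrt (\<ge>) \<alpha> \<and> 0 \<notin> set \<alpha>"

text \<open>Parts are numbered from 1; the value is 0 at index 0 and beyond the length.\<close>

definition part :: "nat list \<Rightarrow> nat \<Rightarrow> nat" where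
  "part \<alpha> i = (if 1 \<le> i \<and> i \<le> length \<alpha> then \<alpha> ! (i - 1) else 0)"

definition sub_partition :: "nat list \<Rightarrow> nat list \<Rightarrow> bool" (infix \<open>\<subseteq>\<^sub>p\<close> 50) where
  "\<alpha> \<subseteq>\<^sub>p \<beta> \<longleftrightarrow> (\<forall>i. part \<alpha> i \<le> part \<beta> i)"

definition kbounded :: "nat \<Rightarrow> nat list set" where
  "kbounded k = {\<alpha>. partition \<alpha> \<and> part \<alpha> 1 \<le> k}"

definition diagram :: "nat list \<Rightarrow> (nat \<times> nat) set" where
  "diagram \<alpha> = {(i, j). 1 \<le> j \<and> j \<le> part \<alpha> i}"

definition skew :: "nat list \<Rightarrow> nat list \<Rightarrow> (nat \<times> nat) set" where
  "skew \<gamma> \<rho> = {(i, j). part \<rho> i < j \<and> j \<le> part \<gamma> i}"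

definition hook_length :: "(nat \<times> nat) set \<Rightarrow> nat \<times> nat \<Rightarrow> nat" where
  "hook_length D = (\<lambda>(i, j). card {(i', j') \<in> D. i' = i \<and> j' \<ge> j \<or> j' = j \<and> i' \<ge> i})"

definition is_kskew :: "nat \<Rightarrow> nat list \<Rightarrow> nat list \<times> nat list \<Rightarrow> bool" where
  "is_kskew k \<alpha> = (\<lambda>(\<gamma>, \<rho>).
     partition \<gamma> \<and> partition \<rho> \<and> \<rho> \<subseteq>\<^sub>p \<gamma> \<and>
     (\<forall>i. card {j. (i, j) \<in> skew \<gamma> \<rho>} = part \<alpha> i) \<and>
     (\<forall>c \<in> skew \<gamma> \<rho>. hook_length (skew \<gamma> \<rho>) c \<le> k) \<and>
     (\<forall>c \<in> diagram \<rho>. hook_length (skew \<gamma> \<rho>) c > k))"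

text \<open>
  A skew diagram is represented by the pair of its outer and inner partition. The last
  condition of \<^const>\<open>is_kskew\<close> excludes empty rows carrying squares of the inner
  partition, so the pair is determined by the set of cells here.
\<close>

definition kskew :: "nat \<Rightarrow> nat list \<Rightarrow> nat list \<times> nat list" where
  "kskew k \<alpha> = (THE D. is_kskew k \<alpha> D)"

text \<open>The columns of the skew diagram are those from 1 to the first part of the outer partition.\<close>

definition kconjugate :: "nat \<Rightarrow> nat list \<Rightarrow> nat list" where
  "kconjugate k \<alpha> = (case kskew k \<alpha> of (\<gamma>, \<rho>) \<Rightarrow>
     map (\<lambda>j. card {i. (i, j) \<in> skew \<gamma> \<rho>}) [1..<Suc (part \<gamma> 1)])"

definition kstep :: "nat \<Rightarrow> nat list \<Rightarrow> nat list \<Rightarrow> bool" where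
  "kstep k \<alpha> \<beta> \<longleftrightarrow> \<alpha> \<in> kbounded k \<and> \<beta> \<in> kbounded k \<and>
     \<alpha> \<subseteq>\<^sub>p \<beta> \<and> kconjugate k \<alpha> \<subseteq>\<^sub>p kconjugate k \<beta> \<and>
     sum_list \<beta> = sum_list \<alpha> + 1"

definition kle :: "nat \<Rightarrow> nat list \<Rightarrow> nat list \<Rightarrow> bool" where
  "kle k = (kstep k)\<^sup>*\<^sup>*"

definition rect_ideal :: "nat \<Rightarrow> nat \<Rightarrow> nat \<Rightarrow> nat list gorder" where
  "rect_ideal k m n = \<lparr>carrier = {\<beta> \<in> kbounded k. kle k \<beta> (replicate n m)}, eq = (=), le = kle k\<rparr>"

locale distributive_lattice = lattice +
  assumes meet_join_distrib:
    "\<lbrakk>x \<in> carrier L; y \<in> carrier L; z \<in> carrier L\<rbrakk>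
      \<Longrightarrow> x \<sqinter> (y \<squnion> z) = (x \<sqinter> y) \<squnion> (x \<sqinter> z)"

end

theory Submission
  imports Defs
begin

text \<open>
  Put \<open>K = k - m + 1\<close>. The ideal below \<open>(m^n)\<close> turns out to consist of the partitions inside the
  rectangle that have at most \<open>K\<close> parts smaller than \<open>m\<close>, and on these partitions the order of
  \<open>Y^k\<close> is plain containment of diagrams (\<open>carrier_rect_ideal\<close>, \<open>kle_of_sub_partition\<close>). This set
  is closed under taking part-wise minima and maxima, so the ideal is a sublattice of Young's
  lattice, and distributivity is that of \<open>min\<close> over \<open>max\<close>.

  The \<open>k\<close>-conjugate enters through the numbers \<open>N(h)\<close> of columns of length at least \<open>h\<close> in the
  \<open>k\<close>-skew diagram. Building the diagram from its highest row downwards, one new lowest row of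
  \<open>x\<close> cells changes these numbers in a simple way: with \<open>t = k + 1 - x\<close>, the row must start right
  after the \<open>N(t)\<close> columns that are at least \<open>t\<close> long, and it lengthens all the other columns by one.
  Hence \<open>(N(1), ..., N(t))\<close> is replaced by \<open>(N(t) + x, N(1), ..., N(t - 1))\<close>, while the entries after
  position \<open>t\<close> stay (\<open>column_count\<close>, \<open>le_column_iff\<close>). Containment of \<open>k\<close>-conjugates is the
  entrywise comparison of these numbers (\<open>kconjugate_sub_iff\<close>).

  For a partition with at most \<open>K\<close> parts smaller than \<open>m\<close>, a row \<open>x < m\<close> finds \<open>N(t)\<close> still zero, so
  it shifts the entries and puts \<open>x\<close> in front; a row of length \<open>m\<close> rotates \<open>(N(1), ..., N(K))\<close> and adds
  \<open>m\<close> to the entry that comes to the front. So \<open>N(h)\<close> vanishes for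
  \<open>h > K\<close>, and it grows with the partition (\<open>column_count_mono\<close>): every containment that
  adds one cell is a covering relation of \<open>Y^k\<close>, and any containment splits into such steps inside the
  set (\<open>short_tail_remove_cell\<close>). Conversely, a partition with parts at most \<open>m\<close> of which more than \<open>K\<close>
  are smaller than \<open>m\<close> has \<open>N(K + 1) > 0\<close> (\<open>column_count_pos_of_long_tail\<close>), so it cannot be below a
  member of the set.
\<close>

section \<open>Parts of partitions\<close>

lemma part_Nil [simp]: "part [] i = 0"
  by (simp add: part_def)

lemma part_0 [simp]: "part \<alpha> 0 = 0"
  by (simp add: part_def)

lemma part_Cons_Suc [simp]: "part (x # \<alpha>) (Suc i) = (if i = 0 then x else part \<alpha> i)"
  by (auto simp: part_def)

lemma part_Cons: "part (x # \<alpha>) i = (if i = 0 then 0 else if i = 1 then x else part \<alpha> (i - 1))"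
  by (cases i) auto

lemma partition_Nil [simp]: "partition []"
  by (simp add: partition_def)

lemma partition_Cons [simp]:
  "partition (x # \<alpha>) \<longleftrightarrow> x > 0 \<and> part \<alpha> 1 \<le> x \<and> partition \<alpha>"
proof (cases \<alpha>)
  case (Cons y \<beta>)
  then show ?thesis by (fastforce simp: partition_def part_def)
qed (auto simp: partition_def)

lemma part_eq_0_iff: "partition \<alpha> \<Longrightarrow> part \<alpha> i = 0 \<longleftrightarrow> i = 0 \<or> length \<alpha> < i"
  by (induction \<alpha> arbitrary: i) (auto simp: part_Cons split: if_splits)

lemma part_antimono: "partition \<alpha> \<Longrightarrow> 1 \<le> i \<Longrightarrow> i \<le> j \<Longrightarrow> part \<alpha> j \<le> part \<alpha> i"
proof (induction \<alpha> arbitrary: i j)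
  case (Cons x \<alpha>)
  show ?case
  proof (cases "i = 1")
    case True
    have "part \<alpha> (j - 1) \<le> part \<alpha> 1" if "j \<noteq> 1"
      using Cons.prems that by (intro Cons.IH) auto
    then show ?thesis
      using Cons.prems True by (cases "j = 1") (auto simp: part_Cons)
  next
    case False
    then show ?thesis
      using Cons.prems Cons.IH[of "i - 1" "j - 1"] by (auto simp: part_Cons)
  qed
qed simp

lemma partition_eqI:
  "partition \<alpha> \<Longrightarrow> partition \<beta> \<Longrightarrow> (\<And>i. part \<alpha> i = part \<beta> i) \<Longrightarrow> \<alpha> = \<beta>"
proof (induction \<alpha> arbitrary: \<beta>)
  case Nil
  then show ?case using Nil.prems(3)[of 1] by (cases \<beta>) auto
next
  case (Cons x \<alpha>)
  then show ?case
  proof (cases \<beta>)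
    case Nil
    then show ?thesis using Cons.prems(1) Cons.prems(3)[of 1] by simp
  next
    case (Cons y \<beta>')
    have "part \<alpha> i = part \<beta>' i" for i
      using Cons.prems(3)[of "Suc i"] Cons by (cases i) auto
    then show ?thesis using Cons.prems Cons.IH[of \<beta>'] Cons Cons.prems(3)[of 1] by simp
  qed
qed

lemma sub_partition_Nil [simp]: "[] \<subseteq>\<^sub>p \<beta>"
  by (simp add: sub_partition_def)

lemma sub_partition_refl [simp]: "\<alpha> \<subseteq>\<^sub>p \<alpha>"
  by (simp add: sub_partition_def)

lemma sub_partition_trans: "\<alpha> \<subseteq>\<^sub>p \<beta> \<Longrightarrow> \<beta> \<subseteq>\<^sub>p \<gamma> \<Longrightarrow> \<alpha> \<subseteq>\<^sub>p \<gamma>"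
  unfolding sub_partition_def using le_trans by blast

lemma sub_partition_antisym:
  "partition \<alpha> \<Longrightarrow> partition \<beta> \<Longrightarrow> \<alpha> \<subseteq>\<^sub>p \<beta> \<Longrightarrow> \<beta> \<subseteq>\<^sub>p \<alpha> \<Longrightarrow> \<alpha> = \<beta>"
  by (rule partition_eqI) (auto simp: sub_partition_def intro: le_antisym)

lemma sub_partition_Cons [simp]: "x # \<alpha> \<subseteq>\<^sub>p y # \<beta> \<longleftrightarrow> x \<le> y \<and> \<alpha> \<subseteq>\<^sub>p \<beta>" (is "?L \<longleftrightarrow> ?R")
proof
  assume L: ?L
  have "part \<alpha> i \<le> part \<beta> i" for i
    using L unfolding sub_partition_def by (cases i) (auto dest: spec[of _ "Suc i"])
  moreover have "x \<le> y"
    using L unfolding sub_partition_def by (auto dest: spec[of _ "Suc 0"])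
  ultimately show ?R by (simp add: sub_partition_def)
qed (auto simp: sub_partition_def part_Cons)

lemma sub_partition_Cons_NilD: "x # \<alpha> \<subseteq>\<^sub>p [] \<Longrightarrow> x = 0"
  by (auto simp: sub_partition_def dest: spec[of _ 1])

section \<open>Counting the columns of a skew diagram by length\<close>

text \<open>
  The number of columns of length at least \<open>h\<close> in the \<open>k\<close>-skew diagram, for \<open>h \<ge> 1\<close>, by recursion
  on the lowest row. It is defined before the diagram, which is then built from it; \<open>le_column_iff\<close>
  confirms the meaning.
\<close>

fun column_count :: "nat \<Rightarrow> nat list \<Rightarrow> nat \<Rightarrow> nat" where
  "column_count k [] h = 0"
| "column_count k (x # \<beta>) h =
     (if h = 1 then column_count k \<beta> (Suc k - x) + x
      else if h \<le> Suc k - x then column_count k \<beta> (h - 1) else column_count k \<beta> h)"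

text \<open>
  Two consistency properties, which need each other in the induction: the numbers decrease
  with \<open>h\<close>, and a further row of \<open>x\<close> cells, put after the columns of length at least
  \<open>k + 1 - x\<close>, reaches at least as far to the right as the present diagram does.
\<close>

lemma column_count_antimono:
  "partition \<alpha> \<Longrightarrow> part \<alpha> 1 \<le> k \<Longrightarrow> 1 \<le> h \<Longrightarrow> h \<le> h' \<Longrightarrow> column_count k \<alpha> h' \<le> column_count k \<alpha> h"
  "partition \<alpha> \<Longrightarrow> part \<alpha> 1 \<le> x \<Longrightarrow> x \<le> k \<Longrightarrow> column_count k \<alpha> 1 \<le> column_count k \<alpha> (Suc k - x) + x"
proof (induction \<alpha> arbitrary: h h' x)
  case (Cons y \<alpha>)
  { case 1
    then have y: "part \<alpha> 1 \<le> y" and p: "partition \<alpha>"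
      and yk: "y \<le> k" and a1: "part \<alpha> 1 \<le> k" by auto
    note IH = Cons.IH(1)[OF p a1] Cons.IH(2)[OF p y yk]
    show ?case
    proof (cases "h' = h")
      case False
      show ?thesis
      proof (cases "h' \<le> Suc k - y")
        case True
        have "column_count k \<alpha> (h' - 1) \<le> column_count k \<alpha> 1" using 1 False by (intro IH(1)) auto
        then show ?thesis using 1 False True IH(1)[of "h - 1" "h' - 1"] IH(2)
          by (cases "h = 1") auto
      next
        case g: False
        then show ?thesis using 1 False IH(1)[of "Suc k - y" h'] IH(1)[of "h - 1" h'] IH(1)[of h h'] yk
          by (cases "h = 1"; cases "h \<le> Suc k - y") auto
      qed
    qed simp
  }
  { case 2
    then have p: "partition \<alpha>" and yk: "y \<le> k" "y \<le> x" and a1: "part \<alpha> 1 \<le> k" by auto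
    note IH = Cons.IH(1)[OF p a1]
    show ?case
    proof (cases "Suc k - x = 1")
      case False
      then have "column_count k \<alpha> (Suc k - y) \<le> column_count k \<alpha> (Suc k - x - 1)"
        using 2 yk by (intro IH) auto
      then show ?thesis using 2 False yk by auto
    qed simp
  }
qed auto

text \<open>
  Each row starts no further to the right than a row \<open>x\<close> put below it, so that the starting points
  of the rows form a partition.
\<close>

lemma column_count_inner_le:
  assumes "partition (y # \<beta>)" "y \<le> x" "x \<le> k"
  shows "column_count k \<beta> (Suc k - y) \<le> column_count k (y # \<beta>) (Suc k - x)"
proof (cases "Suc k - x = 1")
  case False
  then have "column_count k \<beta> (Suc k - y) \<le> column_count k \<beta> (Suc k - x - 1)"
    using assms by (intro column_count_antimono(1)) auto
  then show ?thesis using assms False by auto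
qed simp

section \<open>Existence and uniqueness of the k-skew diagram\<close>

text \<open>
  The strict leg of a square. No row has index 0, so \<open>leg D 0 j\<close> is the length of column \<open>j\<close>.
\<close>

definition leg :: "(nat \<times> nat) set \<Rightarrow> nat \<Rightarrow> nat \<Rightarrow> nat" where
  "leg D i j = card {i'. i < i' \<and> (i', j) \<in> D}"

lemma finite_column: "finite {i. P i \<and> (i, j) \<in> skew \<gamma> \<rho>}"
proof (rule finite_subset)
  show "{i. P i \<and> (i, j) \<in> skew \<gamma> \<rho>} \<subseteq> {..length \<gamma>}"
    by (auto simp: skew_def part_def split: if_splits)
qed simp

lemma hook_length_skew:
  "hook_length (skew \<gamma> \<rho>) (i, j) =
    (Suc (part \<gamma> i) - max (Suc (part \<rho> i)) j) + leg (skew \<gamma> \<rho>) i j"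
proof -
  let ?D = "skew \<gamma> \<rho>"
  let ?A = "Pair i ` {max (Suc (part \<rho> i)) j ..< Suc (part \<gamma> i)}"
  let ?B = "(\<lambda>i'. (i', j)) ` {i'. i < i' \<and> (i', j) \<in> ?D}"
  have "{(i', j') \<in> ?D. i' = i \<and> j' \<ge> j \<or> j' = j \<and> i' \<ge> i} = ?A \<union> ?B"
    by (auto simp: skew_def image_iff)
  moreover have "card (?A \<union> ?B) = card ?A + card ?B"
    by (intro card_Un_disjoint finite_imageI finite_column) auto
  moreover have "card ?A = Suc (part \<gamma> i) - max (Suc (part \<rho> i)) j"
    by (subst card_image) (auto intro: inj_onI)
  moreover have "card ?B = leg ?D i j"
    unfolding leg_def by (subst card_image) (auto intro: inj_onI)
  ultimately show ?thesis by (simp add: hook_length_def)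
qed

lemma card_row_skew: "card {j. (i, j) \<in> skew \<gamma> \<rho>} = part \<gamma> i - part \<rho> i"
proof -
  have "{j. (i, j) \<in> skew \<gamma> \<rho>} = {part \<rho> i <.. part \<gamma> i}" by (auto simp: skew_def)
  then show ?thesis by simp
qed

text \<open>
  The two partitions bounding the \<open>k\<close>-skew diagram. In \<open>inner\<close>, once a row starts in the first
  column, so do all rows above it; the list ends there because partitions have no zero parts.
\<close>

fun outer :: "nat \<Rightarrow> nat list \<Rightarrow> nat list" where
  "outer k [] = []"
| "outer k (x # \<beta>) = column_count k (x # \<beta>) 1 # outer k \<beta>"

fun inner :: "nat \<Rightarrow> nat list \<Rightarrow> nat list" where
  "inner k [] = []"
| "inner k (x # \<beta>) =
     (let s = column_count k \<beta> (Suc k - x) in if s = 0 then [] else s # inner k \<beta>)"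

lemma part_outer_1: "part (outer k \<alpha>) 1 = column_count k \<alpha> 1"
  by (cases \<alpha>) auto

lemma part_inner_le:
  assumes "partition \<beta>" "part \<beta> 1 \<le> x" "x \<le> k"
  shows "part (inner k \<beta>) 1 \<le> column_count k \<beta> (Suc k - x)"
proof (cases \<beta>)
  case (Cons y \<beta>')
  then have "part (inner k \<beta>) 1 = column_count k \<beta>' (Suc k - y)" by (simp add: Let_def)
  also have "\<dots> \<le> column_count k (y # \<beta>') (Suc k - x)"
    using assms Cons by (intro column_count_inner_le) auto
  finally show ?thesis using Cons by simp
qed simp

lemma partition_inner: "partition \<alpha> \<Longrightarrow> part \<alpha> 1 \<le> k \<Longrightarrow> partition (inner k \<alpha>)"
  by (induction \<alpha>) (use part_inner_le in \<open>auto simp: Let_def\<close>)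

text \<open>
  The truncation in the definition of \<open>inner\<close> is invisible at the level of parts.
\<close>

lemma part_inner_Suc:
  assumes "partition (x # \<beta>)" "x \<le> k"
  shows "part (inner k (x # \<beta>)) (Suc i) =
    (if i = 0 then column_count k \<beta> (Suc k - x) else part (inner k \<beta>) i)"
proof -
  have "part (inner k \<beta>) i = 0" if "column_count k \<beta> (Suc k - x) = 0" "i \<noteq> 0"
    using part_inner_le[of \<beta> x k] part_antimono[of "inner k \<beta>" 1 i] partition_inner[of \<beta> k] assms that
    by simp
  then show ?thesis by (auto simp: Let_def)
qed

lemma partition_outer: "partition \<alpha> \<Longrightarrow> part \<alpha> 1 \<le> k \<Longrightarrow> partition (outer k \<alpha>)"
proof (induction \<alpha>)
  case (Cons x \<beta>)
  then show ?case using column_count_antimono(2)[of \<beta> x k] part_outer_1[of k \<beta>] by auto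
qed simp

lemma part_outer: 
  "partition \<alpha> \<Longrightarrow> part \<alpha> 1 \<le> k \<Longrightarrow> part (outer k \<alpha>) i = part (inner k \<alpha>) i + part \<alpha> i"
proof (induction \<alpha> arbitrary: i)
  case (Cons x \<beta>)
  then show ?case
    using part_inner_Suc[of x \<beta> k] by (cases i) (auto simp del: inner.simps)
qed simp

abbreviation kdiagram :: "nat \<Rightarrow> nat list \<Rightarrow> (nat \<times> nat) set" where
  "kdiagram k \<alpha> \<equiv> skew (outer k \<alpha>) (inner k \<alpha>)"

lemma kdiagram_0 [simp]: "(0, j) \<notin> kdiagram k \<alpha>"
  by (auto simp: skew_def)

lemma kdiagram_Cons:
  assumes "partition (x # \<beta>)" "x \<le> k"
  shows "(Suc i, j) \<in> kdiagram k (x # \<beta>) \<longleftrightarrow>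
    (if i = 0 then column_count k \<beta> (Suc k - x) < j \<and> j \<le> column_count k \<beta> (Suc k - x) + x
     else (i, j) \<in> kdiagram k \<beta>)"
  using part_inner_Suc[OF assms] by (auto simp: skew_def simp del: inner.simps)

lemma leg_kdiagram_Cons:
  assumes "partition (x # \<beta>)" "x \<le> k"
  shows "leg (kdiagram k (x # \<beta>)) (Suc i) j = leg (kdiagram k \<beta>) i j"
proof -
  have "{i'. Suc i < i' \<and> (i', j) \<in> kdiagram k (x # \<beta>)} = Suc ` {i'. i < i' \<and> (i', j) \<in> kdiagram k \<beta>}"
    (is "?A = ?B")
  proof (rule Set.set_eqI)
    fix i' show "i' \<in> ?A \<longleftrightarrow> i' \<in> ?B"
      using kdiagram_Cons[OF assms] by (cases i') (auto simp: image_iff)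
  qed
  then show ?thesis by (simp add: leg_def card_image)
qed

lemma column_kdiagram_Cons:
  assumes "partition (x # \<beta>)" "x \<le> k"
  defines "s \<equiv> column_count k \<beta> (Suc k - x)"
  shows "leg (kdiagram k (x # \<beta>)) 0 j = (if s < j \<and> j \<le> s + x then 1 else 0) + leg (kdiagram k \<beta>) 0 j"
proof -
  let ?D = "kdiagram k (x # \<beta>)"
  have "{i. 0 < i \<and> (i, j) \<in> ?D} = {i. i = 1 \<and> (i, j) \<in> ?D} \<union> {i. Suc 0 < i \<and> (i, j) \<in> ?D}"
    by auto
  then have "leg ?D 0 j = card {i. i = 1 \<and> (i, j) \<in> ?D} + leg ?D (Suc 0) j"
    unfolding leg_def by (auto intro!: card_Un_disjoint finite_column)
  moreover have "{i. i = 1 \<and> (i, j) \<in> ?D} = (if s < j \<and> j \<le> s + x then {1} else {})"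
    using kdiagram_Cons[OF assms(1,2), of 0 j] unfolding s_def by auto
  ultimately show ?thesis using leg_kdiagram_Cons[OF assms(1,2)] by simp
qed

text \<open>
  The columns of length at least \<open>h\<close> are exactly the first \<open>column_count k \<alpha> h\<close> ones. This is where
  the recursion for \<open>column_count\<close> is justified: columns of length at least \<open>t = k + 1 - x\<close> are left
  alone by the new row \<open>x\<close>, and the next \<open>x\<close> columns, which include all other non-empty ones, gain a
  cell.
\<close>

lemma le_column_iff:
  "partition \<alpha> \<Longrightarrow> part \<alpha> 1 \<le> k \<Longrightarrow> 1 \<le> j \<Longrightarrow> 1 \<le> h \<Longrightarrow>
    h \<le> leg (kdiagram k \<alpha>) 0 j \<longleftrightarrow> j \<le> column_count k \<alpha> h"
proof (induction \<alpha> arbitrary: h)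
  case Nil
  then show ?case by (simp add: leg_def skew_def)
next
  case (Cons x \<beta>)
  define t where "t = Suc k - x"
  define s where "s = column_count k \<beta> t"
  define H where "H = leg (kdiagram k \<beta>) 0 j"
  have IH: "h \<le> H \<longleftrightarrow> j \<le> column_count k \<beta> h" if "1 \<le> h" for h
    using Cons that by (simp add: H_def)
  have t: "1 \<le> t" using Cons.prems by (simp add: t_def)
  have s: "t \<le> H \<longleftrightarrow> j \<le> s" using IH[OF t] by (simp add: s_def)
  have out: "H = 0" if "j > s + x"
    using IH[of 1] column_count_antimono(2)[of \<beta> x k] Cons.prems that by (simp add: s_def t_def)
  have col: "leg (kdiagram k (x # \<beta>)) 0 j = (if s < j \<and> j \<le> s + x then 1 else 0) + H"
    using Cons.prems column_kdiagram_Cons[of x \<beta> k j] by (simp add: s_def t_def H_def)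
  have cc: "column_count k (x # \<beta>) h = (if h = 1 then s + x
      else if h \<le> t then column_count k \<beta> (h - 1) else column_count k \<beta> h)"
    by (simp add: s_def t_def)
  have h: "h \<le> t \<Longrightarrow> h \<noteq> 1 \<Longrightarrow> j \<le> column_count k \<beta> (h - 1) \<longleftrightarrow> h - 1 \<le> H"
    using IH[of "h - 1"] Cons.prems by simp
  have h': "j \<le> column_count k \<beta> h \<longleftrightarrow> h \<le> H" using IH[of h] Cons.prems by simp
  show ?case
    unfolding col cc using s t out h h' Cons.prems(4)
    by (cases "j \<le> s"; cases "j \<le> s + x"; cases "h = 1"; cases "h \<le> t") auto
qed

lemma hook_length_kdiagram_Cons:
  assumes "partition (x # \<beta>)" "x \<le> k"
  defines "s \<equiv> column_count k \<beta> (Suc k - x)"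
  shows "hook_length (kdiagram k (x # \<beta>)) (Suc i, j) =
    (if i = 0 then Suc (s + x) - max (Suc s) j + leg (kdiagram k \<beta>) 0 j
     else hook_length (kdiagram k \<beta>) (i, j))"
  using leg_kdiagram_Cons[OF assms(1,2)] part_inner_Suc[OF assms(1,2)]
  by (simp add: hook_length_skew s_def del: inner.simps)

text \<open>
  The defining property of \<open>k\<close>-skew diagrams. In the lowest row, a square of column \<open>j\<close> has hook-length
  \<open>x\<close> plus the length of the column above it if it lies below the diagram, and at most that otherwise;
  by the choice of the first cell, the column is longer than \<open>k - x\<close> in the first case only. Hooks of
  higher squares do not see the lowest row.
\<close>

lemma hook_length_kdiagram:
  assumes "1 \<le> j"
  shows "partition \<alpha> \<Longrightarrow> part \<alpha> 1 \<le> k \<Longrightarrow> j \<le> part (outer k \<alpha>) i \<Longrightarrow>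
    hook_length (kdiagram k \<alpha>) (i, j) \<le> k \<longleftrightarrow> part (inner k \<alpha>) i < j"
proof (induction \<alpha> arbitrary: i)
  case (Cons x \<beta>)
  have xk: "partition (x # \<beta>)" "x \<le> k" and b: "partition \<beta>" "part \<beta> 1 \<le> k" using Cons.prems by auto
  let ?s = "column_count k \<beta> (Suc k - x)"
  have s: "Suc k - x \<le> leg (kdiagram k \<beta>) 0 j \<longleftrightarrow> j \<le> ?s"
    using le_column_iff[OF b, of j "Suc k - x"] assms xk by simp
  show ?case
  proof (cases i)
    case 0
    then show ?thesis using Cons.prems assms by simp
  next
    case (Suc i')
    show ?thesis
    proof (cases "i' = 0")
      case True
      then have "j \<le> ?s + x" using Cons.prems Suc by simp
      then show ?thesis
        using s xk True Suc hook_length_kdiagram_Cons[OF xk, of i' j] part_inner_Suc[OF xk, of i']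
        by (cases "j \<le> ?s") (auto simp del: inner.simps)
    next
      case False
      then show ?thesis
        using Cons Suc b hook_length_kdiagram_Cons[OF xk, of i' j] part_inner_Suc[OF xk, of i']
        by (simp del: inner.simps)
    qed
  qed
qed (use assms in simp)

lemma is_kskew_kdiagram:
  assumes "partition \<alpha>" "part \<alpha> 1 \<le> k"
  shows "is_kskew k \<alpha> (outer k \<alpha>, inner k \<alpha>)"
proof -
  have "hook_length (kdiagram k \<alpha>) (i, j) \<le> k" if "(i, j) \<in> kdiagram k \<alpha>" for i j
    using hook_length_kdiagram[of j \<alpha> k i] assms that by (auto simp: skew_def)
  moreover have "k < hook_length (kdiagram k \<alpha>) (i, j)" if "(i, j) \<in> diagram (inner k \<alpha>)" for i j
    using hook_length_kdiagram[of j \<alpha> k i] assms that part_outer[OF assms, of i]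
    by (auto simp: diagram_def)
  ultimately show ?thesis
    using partition_outer partition_inner part_outer assms
    by (auto simp: is_kskew_def sub_partition_def card_row_skew)
qed

text \<open>
  Rows are determined from the top downwards. If two candidates agree above row \<open>i\<close> but start row \<open>i\<close>
  at different places, then the first cell of the one starting earlier lies below the other diagram;
  with equal row lengths and equal columns above, its hook-length is the same in both, a contradiction.
  An empty row has no first cell; there, a square below the other diagram needs a non-empty column above
  it, so that a higher row of the outer partition would be longer than row \<open>i\<close>.
\<close>

lemma is_kskew_unique:
  assumes "is_kskew k \<alpha> (\<gamma>, \<rho>)" "is_kskew k \<alpha> (\<gamma>', \<rho>')"
  shows "(\<gamma>, \<rho>) = (\<gamma>', \<rho>')"
proof -
  have not_less: "\<not> part \<rho> i < part \<rho>' i"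
    if D: "is_kskew k \<alpha> (\<gamma>, \<rho>)" and D': "is_kskew k \<alpha> (\<gamma>', \<rho>')"
      and above: "\<And>i'. i < i' \<Longrightarrow> part \<gamma> i' = part \<gamma>' i' \<and> part \<rho> i' = part \<rho>' i'"
    for \<gamma> \<rho> \<gamma>' \<rho>' i
  proof
    assume less: "part \<rho> i < part \<rho>' i"
    then have i: "1 \<le> i" by (cases i) auto
    have sub: "part \<rho> i \<le> part \<gamma> i" and sub': "part \<rho>' i \<le> part \<gamma>' i"
      using D D' by (auto simp: is_kskew_def sub_partition_def)
    have row: "part \<gamma> i - part \<rho> i = part \<alpha> i" "part \<gamma>' i - part \<rho>' i = part \<alpha> i"
      using D D' by (auto simp: is_kskew_def card_row_skew)
    have "{i'. i < i' \<and> (i', j) \<in> skew \<gamma> \<rho>} = {i'. i < i' \<and> (i', j) \<in> skew \<gamma>' \<rho>'}" for j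
      using above by (auto simp: skew_def)
    then have leg: "leg (skew \<gamma> \<rho>) i j = leg (skew \<gamma>' \<rho>') i j" for j
      by (simp add: leg_def)
    have big: "k < part \<alpha> i + leg (skew \<gamma> \<rho>) i j" if "1 \<le> j" "j \<le> part \<rho>' i" for j
    proof -
      have "k < hook_length (skew \<gamma>' \<rho>') (i, j)"
        using D' that by (auto simp: is_kskew_def diagram_def)
      then show ?thesis using row(2) that by (simp add: hook_length_skew leg)
    qed
    show False
    proof (cases "part \<alpha> i = 0")
      case False
      then have "hook_length (skew \<gamma> \<rho>) (i, Suc (part \<rho> i)) \<le> k"
        using D row(1) by (auto simp: is_kskew_def skew_def)
      then show False using big[of "Suc (part \<rho> i)"] less row(1) by (simp add: hook_length_skew)
    next
      case True
      then have "0 < leg (skew \<gamma> \<rho>) i (part \<rho>' i)" using big[of "part \<rho>' i"] less by simp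
      then have "{i'. i < i' \<and> (i', part \<rho>' i) \<in> skew \<gamma> \<rho>} \<noteq> {}"
        unfolding leg_def using card_gt_0_iff by blast
      then obtain i' where i': "i < i'" "part \<rho>' i \<le> part \<gamma> i'" by (auto simp: skew_def)
      moreover have "part \<gamma> i' \<le> part \<gamma> i"
        using D i i' by (intro part_antimono) (auto simp: is_kskew_def)
      ultimately show False using True row(1) sub less by simp
    qed
  qed
  \<comment> \<open>Above row \<open>n\<close> all parts of the four partitions are 0; this starts the downward induction.\<close>
  define n where "n = length \<gamma> + length \<gamma>' + length \<rho> + length \<rho>'"
  have eq: "part \<gamma> i = part \<gamma>' i \<and> part \<rho> i = part \<rho>' i" for i
  proof (induction "n - i" arbitrary: i rule: less_induct)
    case less
    show ?case
    proof (cases "i \<le> n")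
      case False
      then show ?thesis by (simp add: n_def part_def)
    next
      case True
      have above: "part \<gamma> i' = part \<gamma>' i' \<and> part \<rho> i' = part \<rho>' i'" if "i < i'" for i'
      proof (cases "i' \<le> n")
        case le: True
        then show ?thesis using that by (intro less) simp
      next
        case False
        then show ?thesis by (simp add: n_def part_def)
      qed
      have "part \<rho> i = part \<rho>' i"
        using not_less[OF assms above] not_less[OF assms(2,1)] above by (metis linorder_neqE_nat)
      moreover have "part \<rho> i \<le> part \<gamma> i" "part \<rho>' i \<le> part \<gamma>' i"
        "part \<gamma> i - part \<rho> i = part \<alpha> i" "part \<gamma>' i - part \<rho>' i = part \<alpha> i"
        using assms by (auto simp: is_kskew_def sub_partition_def card_row_skew)
      ultimately show ?thesis by simp
    qed
  qed
  then show ?thesis using assms by (auto simp: is_kskew_def intro!: partition_eqI)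
qed

lemma kskew_eq:
  assumes "partition \<alpha>" "part \<alpha> 1 \<le> k"
  shows "kskew k \<alpha> = (outer k \<alpha>, inner k \<alpha>)"
  unfolding kskew_def
proof (rule the_equality)
  show *: "is_kskew k \<alpha> (outer k \<alpha>, inner k \<alpha>)" by (rule is_kskew_kdiagram[OF assms])
  show "D = (outer k \<alpha>, inner k \<alpha>)" if "is_kskew k \<alpha> D" for D
    using is_kskew_unique[OF _ *, of "fst D" "snd D"] that by simp
qed

lemma part_map_upt: "part (map f [1..<Suc n]) j = (if 1 \<le> j \<and> j \<le> n then f j else 0)"
proof -
  have "map f [1..<Suc n] ! (j - 1) = f j" if "1 \<le> j" "j \<le> n"
    using that by (subst nth_map) (simp_all del: upt_Suc)
  then show ?thesis by (auto simp: part_def simp del: upt_Suc)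
qed

lemma part_kconjugate:
  assumes "partition \<alpha>" "part \<alpha> 1 \<le> k"
  shows "part (kconjugate k \<alpha>) j = (if 1 \<le> j \<and> j \<le> column_count k \<alpha> 1 then leg (kdiagram k \<alpha>) 0 j else 0)"
proof -
  have "leg (kdiagram k \<alpha>) 0 j = card {i. (i, j) \<in> kdiagram k \<alpha>}" for j
  proof -
    have "0 < i" if "(i, j) \<in> kdiagram k \<alpha>" for i
      using that by (cases i) auto
    then have "{i. 0 < i \<and> (i, j) \<in> kdiagram k \<alpha>} = {i. (i, j) \<in> kdiagram k \<alpha>}" by blast
    then show ?thesis by (simp only: leg_def)
  qed
  then show ?thesis
    unfolding kconjugate_def kskew_eq[OF assms] prod.case part_map_upt part_outer_1 by simp
qed

lemma le_part_kconjugate_iff: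
  assumes "partition \<alpha>" "part \<alpha> 1 \<le> k" "1 \<le> j" "1 \<le> h"
  shows "h \<le> part (kconjugate k \<alpha>) j \<longleftrightarrow> j \<le> column_count k \<alpha> h"
proof (cases "j \<le> column_count k \<alpha> 1")
  case True
  then show ?thesis using part_kconjugate[OF assms(1,2)] le_column_iff[OF assms] assms(3) by presburger
next
  case False
  then have "\<not> j \<le> column_count k \<alpha> h" using column_count_antimono(1)[of \<alpha> k 1 h] assms by linarith
  then show ?thesis using part_kconjugate[OF assms(1,2)] False assms(4) by simp
qed

text \<open>
  Containment of partitions is containment of their ordinary conjugates, and \<open>column_count k \<alpha>\<close> lists
  the parts of the ordinary conjugate of the \<open>k\<close>-conjugate.
\<close>

lemma kconjugate_sub_iff:
  assumes "\<alpha> \<in> kbounded k" "\<beta> \<in> kbounded k"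
  shows "kconjugate k \<alpha> \<subseteq>\<^sub>p kconjugate k \<beta> \<longleftrightarrow> (\<forall>h\<ge>1. column_count k \<alpha> h \<le> column_count k \<beta> h)"
proof -
  have iff: "h \<le> part (kconjugate k \<delta>) j \<longleftrightarrow> j \<le> column_count k \<delta> h"
    if "\<delta> \<in> {\<alpha>, \<beta>}" "1 \<le> j" "1 \<le> h" for \<delta> j h
    using that assms le_part_kconjugate_iff by (auto simp: kbounded_def)
  show ?thesis
  proof (intro iffI allI impI)
    fix h :: nat assume sub: "kconjugate k \<alpha> \<subseteq>\<^sub>p kconjugate k \<beta>" and h: "1 \<le> h"
    show "column_count k \<alpha> h \<le> column_count k \<beta> h"
    proof (cases "column_count k \<alpha> h = 0")
      case False
      then have "h \<le> part (kconjugate k \<alpha>) (column_count k \<alpha> h)" using iff h by simp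
      also have "\<dots> \<le> part (kconjugate k \<beta>) (column_count k \<alpha> h)" using sub by (simp add: sub_partition_def)
      finally show ?thesis using iff h False by simp
    qed simp
  next
    assume le: "\<forall>h\<ge>1. column_count k \<alpha> h \<le> column_count k \<beta> h"
    show "kconjugate k \<alpha> \<subseteq>\<^sub>p kconjugate k \<beta>"
      unfolding sub_partition_def
    proof
      fix j
      let ?h = "part (kconjugate k \<alpha>) j"
      show "?h \<le> part (kconjugate k \<beta>) j"
      proof (cases "j = 0 \<or> ?h = 0")
        case False
        then have "j \<le> column_count k \<alpha> ?h" using iff[of \<alpha> j ?h] by simp
        also have "\<dots> \<le> column_count k \<beta> ?h" using le False by simp
        finally show ?thesis using iff[of \<beta> j ?h] False by simp
      qed auto
    qed
  qed
qed

section \<open>Partitions with few parts smaller than m\<close>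

text \<open>
  Partitions inside the rectangle \<open>(m^n)\<close> with at most \<open>K\<close> parts smaller than \<open>m\<close>. If part \<open>i\<close> is the
  first one smaller than \<open>m\<close>, this bound says that part \<open>i + K\<close> is zero. Written in terms of single
  parts, the condition is visibly preserved by part-wise minima and maxima.
\<close>

definition short_tail :: "nat \<Rightarrow> nat \<Rightarrow> nat \<Rightarrow> nat list set" where
  "short_tail m K n = {\<alpha>. partition \<alpha> \<and> part \<alpha> 1 \<le> m \<and> part \<alpha> (Suc n) = 0 \<and>
     (\<forall>i\<ge>1. part \<alpha> i < m \<longrightarrow> part \<alpha> (i + K) = 0)}"

text \<open>
  The recursive form of the condition: if the first part is smaller than \<open>m\<close>, then so are all the
  others, and there are fewer than \<open>K\<close> of them.
\<close>

lemma short_tail_Cons: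
  assumes "1 \<le> K"
  shows "x # \<alpha> \<in> short_tail m K (Suc n) \<longleftrightarrow>
    0 < x \<and> x \<le> m \<and> part \<alpha> 1 \<le> x \<and> (x < m \<longrightarrow> length \<alpha> < K) \<and> \<alpha> \<in> short_tail m K n"
proof -
  define T where "T \<longleftrightarrow> (\<forall>i\<ge>1. part \<alpha> i < m \<longrightarrow> part \<alpha> (i + K) = 0)"
  have "(\<forall>i\<ge>1. part (x # \<alpha>) i < m \<longrightarrow> part (x # \<alpha>) (i + K) = 0) \<longleftrightarrow> (x < m \<longrightarrow> part \<alpha> K = 0) \<and> T"
    (is "?L \<longleftrightarrow> ?R")
  proof
    assume L: ?L
    show ?R
      unfolding T_def using L[rule_format, of 1] L[rule_format, of "Suc _"] assms by auto
  next
    assume R: ?R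
    show ?L
    proof (intro allI impI)
      fix i assume "1 \<le> i" "part (x # \<alpha>) i < m"
      then show "part (x # \<alpha>) (i + K) = 0"
        using R[THEN conjunct2, unfolded T_def, rule_format, of "i - 1"] R[THEN conjunct1] assms
        by (cases "i = 1") (auto simp: part_Cons)
    qed
  qed
  then have Cons: "x # \<alpha> \<in> short_tail m K (Suc n) \<longleftrightarrow>
    partition (x # \<alpha>) \<and> x \<le> m \<and> part \<alpha> (Suc n) = 0 \<and> (x < m \<longrightarrow> part \<alpha> K = 0) \<and> T"
    unfolding short_tail_def mem_Collect_eq by simp
  have tail: "\<alpha> \<in> short_tail m K n \<longleftrightarrow> partition \<alpha> \<and> part \<alpha> 1 \<le> m \<and> part \<alpha> (Suc n) = 0 \<and> T"
    unfolding short_tail_def mem_Collect_eq T_def ..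
  have "part \<alpha> K = 0 \<longleftrightarrow> length \<alpha> < K" if "partition \<alpha>"
    using part_eq_0_iff[OF that, of K] assms by simp
  then show ?thesis
    unfolding Cons tail partition_Cons by (cases "partition \<alpha>"; cases "x \<le> m") auto
qed

lemma Nil_short_tail [simp]: "[] \<in> short_tail m K n"
  by (simp add: short_tail_def)

lemma short_tail_0: "\<alpha> \<in> short_tail m K 0 \<longleftrightarrow> \<alpha> = []"
proof
  assume "\<alpha> \<in> short_tail m K 0"
  then have "partition \<alpha>" "part \<alpha> 1 = 0" by (simp_all add: short_tail_def)
  then show "\<alpha> = []" by (cases \<alpha>) simp_all
qed simp

lemma short_tail_ConsE:
  assumes "x # \<alpha> \<in> short_tail m K n" "1 \<le> K"
  obtains n' where "n = Suc n'" "0 < x" "x \<le> m" "part \<alpha> 1 \<le> x" "x < m \<Longrightarrow> length \<alpha> < K"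
    "\<alpha> \<in> short_tail m K n'"
proof (cases n)
  case 0
  then show thesis using assms(1) by (simp add: short_tail_0)
next
  case (Suc n')
  then show thesis using assms(1) that by (simp add: short_tail_Cons[OF assms(2)])
qed

text \<open>
  No column is longer than \<open>K\<close>: fewer than \<open>K\<close> rows lie above a row smaller than \<open>m\<close>, and a row of
  length \<open>m\<close> is placed after the columns of length \<open>K\<close>.
\<close>

lemma column_count_short_tail_eq_0:
  assumes "m \<le> k" "1 \<le> m" "K = Suc k - m"
  shows "\<alpha> \<in> short_tail m K n \<Longrightarrow> K < h \<or> length \<alpha> < h \<Longrightarrow> column_count k \<alpha> h = 0"
proof (induction \<alpha> arbitrary: n h)
  case (Cons x \<alpha>)
  from Cons.prems(1) obtain n' where x: "n = Suc n'" "0 < x" "x \<le> m" "part \<alpha> 1 \<le> x"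
    "x < m \<Longrightarrow> length \<alpha> < K" and tail: "\<alpha> \<in> short_tail m K n'"
    by (rule short_tail_ConsE) (use assms in auto)
  have "h \<noteq> 1" using Cons.prems assms by auto
  moreover have "column_count k \<alpha> (h - 1) = 0" if "h \<le> Suc k - x"
    using Cons.prems(2) that x assms by (intro Cons.IH[OF tail]) (cases "x = m"; auto)
  moreover have "column_count k \<alpha> h = 0"
    using Cons.prems(2) by (intro Cons.IH[OF tail]) auto
  ultimately show ?case by simp
qed simp

lemma column_count_short_tail_Cons:
  assumes "m \<le> k" "1 \<le> m" "K = Suc k - m" "x # \<alpha> \<in> short_tail m K n" "h \<noteq> 0" "h \<le> K"
  shows "column_count k (x # \<alpha>) h =
    (if h = 1 then (if x = m then column_count k \<alpha> K + m else x) else column_count k \<alpha> (h - 1))"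
proof -
  from assms(4) obtain n' where x: "0 < x" "x \<le> m" "x < m \<Longrightarrow> length \<alpha> < K"
    and tail: "\<alpha> \<in> short_tail m K n'"
    by (rule short_tail_ConsE) (use assms in auto)
  \<comment> \<open>A row shorter than \<open>m\<close> has fewer than \<open>K\<close> rows above it and hence starts in the first column.\<close>
  have "column_count k \<alpha> (Suc k - x) = 0" if "x < m"
    using that assms x by (intro column_count_short_tail_eq_0[OF assms(1-3) tail]) auto
  then show ?thesis using assms x by auto
qed

text \<open>
  Within the set, the \<open>k\<close>-conjugate is monotone for containment, because by
  \<open>column_count_short_tail_Cons\<close> rows of any length move the entries \<open>1, ..., K\<close> in the same way; only
  the entry coming to the front depends on the row, and it is largest for a row of length \<open>m\<close>.
\<close>

lemma column_count_mono:
  assumes "m \<le> k" "1 \<le> m" "K = Suc k - m"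
  shows "\<alpha> \<in> short_tail m K n \<Longrightarrow> \<beta> \<in> short_tail m K n' \<Longrightarrow> \<alpha> \<subseteq>\<^sub>p \<beta> \<Longrightarrow>
    h \<noteq> 0 \<Longrightarrow> column_count k \<alpha> h \<le> column_count k \<beta> h"
proof (induction \<alpha> arbitrary: \<beta> n n' h)
  case (Cons x \<alpha>)
  have K: "1 \<le> K" using assms by simp
  from Cons.prems(1) K obtain n1 where x: "0 < x" "x \<le> m" and tail: "\<alpha> \<in> short_tail m K n1"
    by (rule short_tail_ConsE)
  obtain y \<beta>' where b: "\<beta> = y # \<beta>'" using Cons.prems(3) x by (cases \<beta>) (auto dest: sub_partition_Cons_NilD)
  from Cons.prems(2)[unfolded b] K obtain n2 where tail': "\<beta>' \<in> short_tail m K n2" and y: "y \<le> m"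
    by (rule short_tail_ConsE)
  have sub: "x \<le> y" "\<alpha> \<subseteq>\<^sub>p \<beta>'" using Cons.prems(3) by (auto simp: b)
  note IH = Cons.IH[OF tail tail' sub(2)]
  show ?case
  proof (cases "h \<le> K")
    case True
    then show ?thesis
      using column_count_short_tail_Cons[OF assms Cons.prems(1,4)]
        column_count_short_tail_Cons[OF assms Cons.prems(2)[unfolded b] Cons.prems(4)] IH[of K] IH[of "h - 1"]
        sub x y K Cons.prems(4) unfolding b
      by (simp del: column_count.simps)
  next
    case False
    then show ?thesis
      using column_count_short_tail_eq_0[OF assms Cons.prems(1), of h] by simp
  qed
qed simp

text \<open>
  Rows shorter than \<open>m\<close> all start in the first column as long as there are at most \<open>K + 1\<close> of them,
  so the first column reaches that length.
\<close>

lemma column_count_pos_of_small_parts: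
  assumes "m \<le> k" "K = Suc k - m"
  shows "partition \<alpha> \<Longrightarrow> part \<alpha> 1 < m \<Longrightarrow> h \<noteq> 0 \<Longrightarrow> h \<le> length \<alpha> \<Longrightarrow> h \<le> Suc K \<Longrightarrow> 0 < column_count k \<alpha> h"
  using assms by (induction \<alpha> arbitrary: h) auto

text \<open>
  With more than \<open>K\<close> parts smaller than \<open>m\<close>, a column of length \<open>K + 1\<close> appears already in the rows of
  these parts; the rows of length \<open>m\<close> below them affect only columns shorter than \<open>K\<close>.
\<close>

lemma column_count_pos_of_long_tail:
  assumes "m \<le> k" "1 \<le> m" "K = Suc k - m"
  shows "partition \<alpha> \<Longrightarrow> part \<alpha> 1 \<le> m \<Longrightarrow> length \<alpha> \<le> n \<Longrightarrow> \<alpha> \<notin> short_tail m K n \<Longrightarrow>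
    0 < column_count k \<alpha> (Suc K)"
proof (induction \<alpha> arbitrary: n)
  case (Cons x \<alpha>)
  then obtain n' where n: "n = Suc n'" by (cases n) auto
  have K: "1 \<le> K" using assms by simp
  show ?case
  proof (cases "x < m")
    case True
    have "K \<le> length \<alpha>"
    proof (rule ccontr)
      assume "\<not> K \<le> length \<alpha>"
      then have "\<alpha> \<in> short_tail m K n'"
        using Cons.prems n True K by (auto simp: short_tail_def part_eq_0_iff)
      then show False using Cons.prems n True K \<open>\<not> K \<le> length \<alpha>\<close> by (simp add: short_tail_Cons)
    qed
    then show ?thesis
      using True Cons.prems assms K column_count_pos_of_small_parts[OF assms(1,3), of \<alpha> K] by auto
  next
    case False
    then have "x = m" using Cons.prems by simp
    then have "\<alpha> \<notin> short_tail m K n'" using Cons.prems n K by (simp add: short_tail_Cons)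
    then have "0 < column_count k \<alpha> (Suc K)" using Cons.prems n \<open>x = m\<close> by (intro Cons.IH[of n']) auto
    then show ?thesis using \<open>x = m\<close> assms by simp
  qed
qed simp

section \<open>The ideal generated by a rectangle\<close>

lemma short_tail_kbounded: "m \<le> k \<Longrightarrow> short_tail m K n \<subseteq> kbounded k"
  by (auto simp: short_tail_def kbounded_def)

lemma kstep_short_tail:
  assumes "m \<le> k" "1 \<le> m" "K = Suc k - m" "kstep k \<alpha> \<beta>" "\<beta> \<in> short_tail m K n"
  shows "\<alpha> \<in> short_tail m K n"
proof (rule ccontr)
  assume "\<alpha> \<notin> short_tail m K n"
  moreover have "\<alpha> \<subseteq>\<^sub>p \<beta>" and p: "partition \<alpha>" using assms by (auto simp: kstep_def kbounded_def)
  then have "part \<alpha> 1 \<le> part \<beta> 1" "part \<alpha> (Suc n) \<le> part \<beta> (Suc n)"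
    by (simp_all add: sub_partition_def)
  then have "part \<alpha> 1 \<le> m" "length \<alpha> \<le> n"
    using assms(5) part_eq_0_iff[OF p, of "Suc n"] by (auto simp: short_tail_def)
  ultimately have "0 < column_count k \<alpha> (Suc K)" using column_count_pos_of_long_tail[OF assms(1-3) p] by simp
  moreover have "column_count k \<alpha> (Suc K) \<le> column_count k \<beta> (Suc K)"
    using assms(4) kconjugate_sub_iff[of \<alpha> k \<beta>] by (simp add: kstep_def)
  moreover have "column_count k \<beta> (Suc K) = 0" using column_count_short_tail_eq_0[OF assms(1-3,5)] by simp
  ultimately show False by simp
qed

text \<open>
  The last cell of the highest row in which \<open>\<alpha>\<close> and \<open>\<beta>\<close> differ can be removed from \<open>\<beta>\<close>. If this creates
  a new part smaller than \<open>m\<close>, then \<open>\<alpha>\<close> has a part smaller than \<open>m\<close> in that row too and the same parts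
  after it, so the bound \<open>K\<close> for \<open>\<alpha>\<close> gives the bound for the new partition; or \<open>\<alpha>\<close> has no part there,
  and the new part is the only one smaller than \<open>m\<close>.
\<close>

lemma short_tail_remove_cell:
  assumes K: "1 \<le> K"
  shows "\<alpha> \<in> short_tail m K n \<Longrightarrow> \<beta> \<in> short_tail m K n \<Longrightarrow> \<alpha> \<subseteq>\<^sub>p \<beta> \<Longrightarrow> \<alpha> \<noteq> \<beta> \<Longrightarrow>
    \<exists>\<delta> \<in> short_tail m K n. \<alpha> \<subseteq>\<^sub>p \<delta> \<and> \<delta> \<subseteq>\<^sub>p \<beta> \<and> length \<delta> \<le> length \<beta> \<and> sum_list \<beta> = sum_list \<delta> + 1"
proof (induction \<beta> arbitrary: \<alpha> n)
  case Nil
  then have "partition \<alpha>" by (simp add: short_tail_def)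
  with Nil show ?case by (cases \<alpha>) (auto dest: sub_partition_Cons_NilD)
next
  case (Cons y \<beta>)
  obtain n' where n: "n = Suc n'" and y: "0 < y" "y \<le> m" "part \<beta> 1 \<le> y"
    "y < m \<Longrightarrow> length \<beta> < K" and b: "\<beta> \<in> short_tail m K n'"
    using short_tail_ConsE[OF Cons.prems(2) K] by blast
  define x where "x = part \<alpha> 1"
  define \<alpha>' where "\<alpha>' = tl \<alpha>"
  have x: "x \<le> y" using Cons.prems(3) unfolding x_def sub_partition_def by (auto dest: spec[of _ 1])
  have a: "\<alpha>' \<in> short_tail m K n'" and sub: "\<alpha>' \<subseteq>\<^sub>p \<beta>"
    using Cons.prems(1,3) K unfolding \<alpha>'_def n by (cases \<alpha>; simp add: short_tail_Cons)+
  have lift: "\<alpha> \<subseteq>\<^sub>p z # \<delta>" if "x \<le> z" "\<alpha>' \<subseteq>\<^sub>p \<delta>" for z \<delta>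
    using that unfolding x_def \<alpha>'_def by (cases \<alpha>) auto
  show ?case
  proof (cases "\<alpha>' = \<beta>")
    case False
    from Cons.IH[OF a b sub False] obtain \<delta> where d: "\<delta> \<in> short_tail m K n'" "\<alpha>' \<subseteq>\<^sub>p \<delta>" "\<delta> \<subseteq>\<^sub>p \<beta>"
      "length \<delta> \<le> length \<beta>" "sum_list \<beta> = sum_list \<delta> + 1" by blast
    have "part \<delta> 1 \<le> y" using d(3) y(3) unfolding sub_partition_def by (meson le_trans)
    then have "y # \<delta> \<in> short_tail m K n" using K y d by (auto simp: n short_tail_Cons)
    then show ?thesis using d lift x by (intro bexI[of _ "y # \<delta>"]) auto
  next
    case True
    have nil: "\<beta> = []" if "\<alpha> = []" using that True by (simp add: \<alpha>'_def)
    have Cs: "\<alpha> = x # \<beta>" if "\<alpha> \<noteq> []" using that True by (cases \<alpha>) (auto simp: x_def \<alpha>'_def)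
    have xy: "x < y"
      using x Cons.prems(4) nil Cs y by (cases "\<alpha> = []") (auto simp: x_def le_less)
    show ?thesis
    proof (cases "y = 1")
      case True
      then have "\<alpha> = []" using xy Cs Cons.prems(1) K by (cases "\<alpha> = []") (auto simp: n short_tail_Cons)
      then show ?thesis using nil True by (intro bexI[of _ "[]"]) auto
    next
      case False
      have "part \<beta> 1 \<le> x" "length \<beta> < K"
        using nil Cs Cons.prems(1) K xy y by (cases "\<alpha> = []"; auto simp: n short_tail_Cons)+
      then have "(y - 1) # \<beta> \<in> short_tail m K n" using K y b xy False by (auto simp: n short_tail_Cons)
      then show ?thesis using lift[of "y - 1" \<beta>] xy \<open>\<alpha>' = \<beta>\<close> y
        by (intro bexI[of _ "(y - 1) # \<beta>"]) auto
    qed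
  qed
qed

lemma kle_of_sub_partition:
  assumes "m \<le> k" "1 \<le> m" "K = Suc k - m"
  shows "\<alpha> \<in> short_tail m K n \<Longrightarrow> \<beta> \<in> short_tail m K n \<Longrightarrow> \<alpha> \<subseteq>\<^sub>p \<beta> \<Longrightarrow> kle k \<alpha> \<beta>"
proof (induction "sum_list \<beta>" arbitrary: \<beta> rule: less_induct)
  case less
  show ?case
  proof (cases "\<alpha> = \<beta>")
    case False
    with less.prems obtain \<delta> where d: "\<delta> \<in> short_tail m K n" "\<alpha> \<subseteq>\<^sub>p \<delta>" "\<delta> \<subseteq>\<^sub>p \<beta>"
      "sum_list \<beta> = sum_list \<delta> + 1"
      using short_tail_remove_cell[of K \<alpha> m n \<beta>] assms by fastforce
    have kb: "\<delta> \<in> kbounded k" "\<beta> \<in> kbounded k"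
      using short_tail_kbounded[OF assms(1)] d less.prems by blast+
    have "kstep k \<delta> \<beta>"
      using kb d column_count_mono[OF assms d(1) less.prems(2) d(3)] kconjugate_sub_iff[OF kb]
      by (simp add: kstep_def)
    moreover have "kle k \<alpha> \<delta>" using less d by simp
    ultimately show ?thesis by (simp add: kle_def)
  qed (simp add: kle_def)
qed

lemma sub_partition_of_kle: "kle k \<alpha> \<beta> \<Longrightarrow> \<alpha> \<subseteq>\<^sub>p \<beta>"
  unfolding kle_def
  by (induction rule: rtranclp_induct) (auto simp: kstep_def intro: sub_partition_trans)

lemma part_replicate: "part (replicate n m) i = (if 1 \<le> i \<and> i \<le> n then m else 0)"
  by (auto simp: part_def)

lemma partition_replicate: "1 \<le> m \<Longrightarrow> partition (replicate n m)"
  by (auto simp: partition_def sorted_wrt_iff_nth_less)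

lemma carrier_rect_ideal:
  assumes "m \<le> k" "1 \<le> m" "K = Suc k - m"
  shows "carrier (rect_ideal k m n) = short_tail m K n"
proof -
  have R: "replicate n m \<in> short_tail m K n"
    using assms by (auto simp: short_tail_def part_replicate partition_replicate)
  have "\<alpha> \<in> short_tail m K n" if "kle k \<alpha> (replicate n m)" for \<alpha>
    using that unfolding kle_def
    by (induction rule: converse_rtranclp_induct) (use R kstep_short_tail[OF assms] in auto)
  moreover have "kle k \<alpha> (replicate n m)" if a: "\<alpha> \<in> short_tail m K n" for \<alpha>
  proof (rule kle_of_sub_partition[OF assms a R])
    have p: "partition \<alpha>" "part \<alpha> 1 \<le> m" "part \<alpha> (Suc n) = 0" using a by (auto simp: short_tail_def)
    show "\<alpha> \<subseteq>\<^sub>p replicate n m"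
      unfolding sub_partition_def
    proof
      fix i
      consider "i = 0" | "1 \<le> i" "i \<le> n" | "Suc n \<le> i" by linarith
      then show "part \<alpha> i \<le> part (replicate n m) i"
        using part_antimono[OF p(1), of 1 i] part_antimono[OF p(1), of "Suc n" i] p
        by cases (auto simp: part_replicate)
    qed
  qed
  moreover have "short_tail m K n \<subseteq> kbounded k" using assms short_tail_kbounded by simp
  ultimately show ?thesis by (auto simp: rect_ideal_def)
qed

section \<open>Distributivity\<close>

fun min_parts :: "nat list \<Rightarrow> nat list \<Rightarrow> nat list" where
  "min_parts (x # \<alpha>) (y # \<beta>) = min x y # min_parts \<alpha> \<beta>"
| "min_parts _ _ = []"

fun max_parts :: "nat list \<Rightarrow> nat list \<Rightarrow> nat list" where
  "max_parts (x # \<alpha>) (y # \<beta>) = max x y # max_parts \<alpha> \<beta>"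
| "max_parts [] \<beta> = \<beta>"
| "max_parts \<alpha> [] = \<alpha>"

lemma part_min_parts [simp]: "part (min_parts \<alpha> \<beta>) i = min (part \<alpha> i) (part \<beta> i)"
  by (induction \<alpha> \<beta> arbitrary: i rule: min_parts.induct) (auto simp: part_Cons)

lemma part_max_parts [simp]: "part (max_parts \<alpha> \<beta>) i = max (part \<alpha> i) (part \<beta> i)"
  by (induction \<alpha> \<beta> arbitrary: i rule: max_parts.induct) (auto simp: part_Cons)

lemma partition_min_parts: "partition \<alpha> \<Longrightarrow> partition \<beta> \<Longrightarrow> partition (min_parts \<alpha> \<beta>)"
  by (induction \<alpha> \<beta> rule: min_parts.induct) auto

lemma partition_max_parts: "partition \<alpha> \<Longrightarrow> partition \<beta> \<Longrightarrow> partition (max_parts \<alpha> \<beta>)"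
  by (induction \<alpha> \<beta> rule: max_parts.induct) auto

lemma min_parts_short_tail:
  "\<alpha> \<in> short_tail m K n \<Longrightarrow> \<beta> \<in> short_tail m K n \<Longrightarrow> min_parts \<alpha> \<beta> \<in> short_tail m K n"
  by (auto simp: short_tail_def partition_min_parts min_def)

lemma max_parts_short_tail:
  "\<alpha> \<in> short_tail m K n \<Longrightarrow> \<beta> \<in> short_tail m K n \<Longrightarrow> max_parts \<alpha> \<beta> \<in> short_tail m K n"
  by (auto simp: short_tail_def partition_max_parts)

text \<open>
  The operations of the lattice are choices of least upper and greatest lower bounds; by uniqueness they
  are the given operations \<open>jn\<close> and \<open>mt\<close>.
\<close>

lemma distributive_latticeI:
  fixes L (structure)
  assumes po: "partial_order L"
    and jn: "\<And>x y. x \<in> carrier L \<Longrightarrow> y \<in> carrier L \<Longrightarrow> least L (jn x y) (Upper L {x, y})"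
    and mt: "\<And>x y. x \<in> carrier L \<Longrightarrow> y \<in> carrier L \<Longrightarrow> greatest L (mt x y) (Lower L {x, y})"
    and distrib: "\<And>x y z. x \<in> carrier L \<Longrightarrow> y \<in> carrier L \<Longrightarrow> z \<in> carrier L \<Longrightarrow>
      mt x (jn y z) = jn (mt x y) (mt x z)"
  shows "distributive_lattice L"
proof -
  interpret partial_order L by (rule po)
  interpret lattice L
    by unfold_locales (use jn mt in blast)+
  have join: "x \<squnion> y = jn x y" if "x \<in> carrier L" "y \<in> carrier L" for x y
    unfolding join_def sup_def by (rule some_equality) (use jn[OF that] least_unique in blast)+
  have meet: "x \<sqinter> y = mt x y" if "x \<in> carrier L" "y \<in> carrier L" for x y
    unfolding meet_def inf_def by (rule some_equality) (use mt[OF that] greatest_unique in blast)+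
  show ?thesis
  proof unfold_locales
    fix x y z assume xyz: "x \<in> carrier L" "y \<in> carrier L" "z \<in> carrier L"
    have "x \<sqinter> (y \<squnion> z) = mt x (jn y z)"
      using meet[OF xyz(1) join_closed[OF xyz(2,3)]] join[OF xyz(2,3)] by simp
    also have "\<dots> = jn (mt x y) (mt x z)" by (rule distrib[OF xyz])
    also have "\<dots> = (x \<sqinter> y) \<squnion> (x \<sqinter> z)"
      using join[OF meet_closed[OF xyz(1,2)] meet_closed[OF xyz(1,3)]] meet[OF xyz(1,2)] meet[OF xyz(1,3)]
      by simp
    finally show "x \<sqinter> (y \<squnion> z) = (x \<sqinter> y) \<squnion> (x \<sqinter> z)" .
  qed
qed

theorem corollary36:
  fixes m n k :: nat
  assumes "m \<ge> 1" and "n \<ge> 1" and "k \<ge> m"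
  shows "distributive_lattice (rect_ideal k m n)"
proof -
  let ?L = "rect_ideal k m n"
  define S where "S = short_tail m (Suc k - m) n"
  have carrier: "carrier ?L = S"
    using carrier_rect_ideal[OF assms(3,1) refl] by (simp add: S_def)
  have le: "le ?L \<alpha> \<beta> \<longleftrightarrow> \<alpha> \<subseteq>\<^sub>p \<beta>" if "\<alpha> \<in> S" "\<beta> \<in> S" for \<alpha> \<beta>
    using kle_of_sub_partition[OF assms(3,1) refl, of \<alpha> n \<beta>] sub_partition_of_kle that
    by (auto simp: rect_ideal_def S_def)
  have eq: "eq ?L = (=)" by (simp add: rect_ideal_def)
  have S: "partition \<alpha>" if "\<alpha> \<in> S" for \<alpha> using that by (simp add: S_def short_tail_def)
  have closed: "min_parts \<alpha> \<beta> \<in> S" "max_parts \<alpha> \<beta> \<in> S" if "\<alpha> \<in> S" "\<beta> \<in> S" for \<alpha> \<beta>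
    using that min_parts_short_tail max_parts_short_tail by (auto simp: S_def)
  show ?thesis
  proof (rule distributive_latticeI[where jn = max_parts and mt = min_parts])
    show "partial_order ?L"
      by unfold_locales
        (auto simp: carrier eq le intro: sub_partition_trans sub_partition_antisym S)
  next
    fix \<alpha> \<beta> assume "\<alpha> \<in> carrier ?L" "\<beta> \<in> carrier ?L"
    then have ab: "\<alpha> \<in> S" "\<beta> \<in> S" by (simp_all add: carrier)
    show "least ?L (max_parts \<alpha> \<beta>) (Upper ?L {\<alpha>, \<beta>})"
      using ab closed by (auto simp: least_def Upper_def carrier le sub_partition_def)
    show "greatest ?L (min_parts \<alpha> \<beta>) (Lower ?L {\<alpha>, \<beta>})"
      using ab closed by (auto simp: greatest_def Lower_def carrier le sub_partition_def)
  next
    fix \<alpha> \<beta> \<gamma> assume "\<alpha> \<in> carrier ?L" "\<beta> \<in> carrier ?L" "\<gamma> \<in> carrier ?L"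
    then show "min_parts \<alpha> (max_parts \<beta> \<gamma>) = max_parts (min_parts \<alpha> \<beta>) (min_parts \<alpha> \<gamma>)"
      unfolding carrier by (intro partition_eqI S closed) (simp_all add: min_max_distrib2)
  qed
qed

end
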